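(* Let $H$ be a nonzero complex Hilbert space, let $X$ be a complex linear space with an $L(H)$-valued norm $F:X\to L(H)$, let $\{x_n\}_{n=0}^\infty$ be a sequence in $X$, and let $x\in X$. Then the following are equivalent: (a) the sequence $\{x_n\}_{n=0}^\infty$ converges to $x$ with respect to the norm metric defined by $F$; (b) for every $\epsilon>0$ there is a natural number $N(\epsilon)$ such that $\|F(x_n-x)\|\le\epsilon$ for all $n\ge N(\epsilon)$.
   Context: $L(H)$ denotes the bounded linear operators on $H$ with the operator norm, and $S\le T$ means that $T-S$ is a positive operator, where an operator $P$ is positive if $(Ph,h)\ge 0$ for all $h\in H$. $I_H$ is the identity operator on $H$. An $L(H)$-valued norm on $X$ is a function $F:X\to L(H)$ such that (1) $F(x)\ge 0$ for all $x$; (2) $F(x+y)\le F(x)+F(y)$ for all $x,y$; (3) $F(\lambda x)=|\lambda|F(x)$ for all $\lambda\in\mathbb{C}$, $x\in X$; (4) $F(x)=0$ if and only if $x=0$. A sequence $\{x_n\}$ in $X$ converges to $x\in X$ with respect to the norm metric defined by $F$ if for every $\epsilon>0$ there is a natural number $N(\epsilon)$ such that $F(x_n-x)\le\epsilon I_H$ for all $n\ge N(\epsilon)$. *)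

theory Defs
  imports "HOL-Analysis.Analysis"
begin

class complex_vector = ab_group_add +
  fixes scaleC :: "complex \<Rightarrow> 'a \<Rightarrow> 'a" (infixr "*\<^sub>C" 75)
  assumes scaleC_add_right: "a *\<^sub>C (x + y) = a *\<^sub>C x + a *\<^sub>C y"
    and scaleC_add_left: "(a + b) *\<^sub>C x = a *\<^sub>C x + b *\<^sub>C x"
    and scaleC_scaleC: "a *\<^sub>C b *\<^sub>C x = (a * b) *\<^sub>C x"
    and scaleC_one: "1 *\<^sub>C x = x"

lemma vector_space_scaleC: "vector_space (scaleC :: complex \<Rightarrow> 'a \<Rightarrow> 'a::complex_vector)"
  by unfold_locales (simp_all add: scaleC_add_right scaleC_add_left scaleC_scaleC scaleC_one)

text \<open>
  The normed-space axioms inherited from \<^class>\<open>banach\<close> follow from the remaining ones, apart from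
  completeness and the definitions of distance and topology; the class is used so that the
  library's bounded operators and operator norm are available. The inner product is linear in
  its first argument.
\<close>

class complex_hilbert = complex_vector + banach +
  fixes cinner :: "'a \<Rightarrow> 'a \<Rightarrow> complex"
  assumes scaleR_eq_scaleC: "r *\<^sub>R x = complex_of_real r *\<^sub>C x"
    and cinner_commute: "cinner x y = cnj (cinner y x)"
    and cinner_add_left: "cinner (x + y) z = cinner x z + cinner y z"
    and cinner_scaleC_left: "cinner (a *\<^sub>C x) y = a * cinner x y"
    and cinner_nonneg: "cinner x x \<in> \<real>\<^sub>\<ge>\<^sub>0"
    and cinner_eq_zero_iff: "cinner x x = 0 \<longleftrightarrow> x = 0"
    and norm_eq_sqrt_cinner: "norm x = sqrt (Re (cinner x x))"

instantiation complex :: complex_hilbert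
begin

definition scaleC_complex :: "complex \<Rightarrow> complex \<Rightarrow> complex"
  where "scaleC_complex a x = a * x"

definition cinner_complex :: "complex \<Rightarrow> complex \<Rightarrow> complex"
  where "cinner_complex x y = x * cnj y"

instance
  by standard
    (simp_all add: scaleC_complex_def cinner_complex_def algebra_simps scaleR_conv_of_real
      complex_nonneg_Reals_iff cmod_def power2_eq_square)

end

text \<open>
  The type \<open>'h \<Rightarrow>\<^sub>L 'h\<close> consists of the real-linear bounded maps, so \<open>L(H)\<close> is the set of its
  complex-linear elements; the operator norm is the \<^const>\<open>norm\<close> of that type.
\<close>

definition operators :: "('h::complex_hilbert \<Rightarrow>\<^sub>L 'h) set"
  where "operators = {T :: 'h \<Rightarrow>\<^sub>L 'h. \<forall>a h. T (a *\<^sub>C h) = a *\<^sub>C T h}"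

text \<open>Membership in \<open>\<real>\<^sub>\<ge>\<^sub>0\<close> includes the requirement that \<open>(Ph,h)\<close> is real.\<close>

definition positive_op :: "('h::complex_hilbert \<Rightarrow>\<^sub>L 'h) \<Rightarrow> bool"
  where "positive_op P \<longleftrightarrow> (\<forall>h. cinner (P h) h \<in> \<real>\<^sub>\<ge>\<^sub>0)"

definition op_le :: "('h::complex_hilbert \<Rightarrow>\<^sub>L 'h) \<Rightarrow> ('h \<Rightarrow>\<^sub>L 'h) \<Rightarrow> bool" (infix "\<preceq>" 50)
  where "S \<preceq> T \<longleftrightarrow> positive_op (T - S)"

definition operator_valued_norm :: "('x::complex_vector \<Rightarrow> ('h::complex_hilbert \<Rightarrow>\<^sub>L 'h)) \<Rightarrow> bool"
  where "operator_valued_norm F \<longleftrightarrow>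
    (\<forall>x. F x \<in> operators) \<and>
    (\<forall>x. 0 \<preceq> F x) \<and>
    (\<forall>x y. F (x + y) \<preceq> F x + F y) \<and>
    (\<forall>a x. F (a *\<^sub>C x) = cmod a *\<^sub>R F x) \<and>
    (\<forall>x. F x = 0 \<longleftrightarrow> x = 0)"

definition converges_wrt ::
    "('x::complex_vector \<Rightarrow> ('h::complex_hilbert \<Rightarrow>\<^sub>L 'h)) \<Rightarrow> (nat \<Rightarrow> 'x) \<Rightarrow> 'x \<Rightarrow> bool"
  where "converges_wrt F xs x \<longleftrightarrow>
    (\<forall>\<epsilon>>0. \<exists>N. \<forall>n\<ge>N. F (xs n - x) \<preceq> \<epsilon> *\<^sub>R id_blinfun)"

end

theory Submission
  imports Defs
begin

text \<open>
  The two conditions agree operator by operator: for a positive operator \<open>P\<close> and \<open>\<epsilon> \<ge> 0\<close>, the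
  inequality \<open>P \<preceq> \<epsilon> I\<close> says the same as \<open>\<parallel>P\<parallel> \<le> \<epsilon>\<close> (\<open>op_le_scaled_id_iff\<close>). Applied to the positive
  operators \<open>F (xs n - x)\<close>, this turns either form of convergence into the other with the same \<open>N\<close>.

  Both halves of the equivalence are instances of the Cauchy-Schwarz inequality for a positive
  semidefinite sesquilinear form (\<open>Cauchy_Schwarz_semidefinite\<close>). For the inner product itself it
  gives \<open>(Ph,h) \<le> \<parallel>P\<parallel> \<parallel>h\<parallel>\<^sup>2\<close>, so a norm bound is an operator bound. Conversely, if
  \<open>(Ph,h) \<le> \<epsilon> \<parallel>h\<parallel>\<^sup>2\<close> for all \<open>h\<close>, then the inequality for the form \<open>(Ph,k)\<close> with \<open>k = Ph\<close> reads
  \<open>\<parallel>Ph\<parallel>\<^sup>4 \<le> (Ph,h) (PPh,Ph) \<le> \<epsilon>\<^sup>2 \<parallel>h\<parallel>\<^sup>2 \<parallel>Ph\<parallel>\<^sup>2\<close>, whence \<open>\<parallel>Ph\<parallel> \<le> \<epsilon> \<parallel>h\<parallel>\<close>.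
\<close>

text \<open>
  The left-hand side of the hypothesis is the value of a sesquilinear form at \<open>u + a v\<close>, expanded
  in its values \<open>p, q, r, s\<close> at \<open>(u,u)\<close>, \<open>(u,v)\<close>, \<open>(v,u)\<close>, \<open>(v,v)\<close>. That the values are real forces
  \<open>r = cnj q\<close>; that they are nonnegative along the line \<open>a = - t q\<close>, \<open>t\<close> real, bounds \<open>q\<close>.
\<close>

lemma semidefinite_expansion_bound:
  fixes p q r s :: complex
  assumes p: "p \<in> \<real>\<^sub>\<ge>\<^sub>0" and s: "s \<in> \<real>\<^sub>\<ge>\<^sub>0"
    and expansion: "\<And>a. p + cnj a * q + a * r + a * cnj a * s \<in> \<real>\<^sub>\<ge>\<^sub>0"
  shows "(cmod q)\<^sup>2 \<le> Re p * Re s"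
proof -
  have Im0: "Im p = 0" "Im s = 0" and Re_nonneg: "Re p \<ge> 0" "Re s \<ge> 0"
    using p s by (auto simp: complex_nonneg_Reals_iff)
  have "Im r = - Im q"
    using expansion[of 1] Im0 by (simp add: complex_nonneg_Reals_iff)
  moreover have "Re r = Re q"
    using expansion[of \<i>] Im0 by (simp add: complex_nonneg_Reals_iff)
  ultimately have r: "r = cnj q"
    by (simp add: complex_eq_iff)
  define m where "m = (cmod q)\<^sup>2"
  have m: "m = Re q * Re q + Im q * Im q"
    by (simp add: m_def cmod_power2 flip: power2_eq_square)
  have quadratic: "Re p - 2 * t * m + t * t * m * Re s \<ge> 0" for t
    using expansion[of "- of_real t * q"] Im0
    by (simp add: complex_nonneg_Reals_iff r m algebra_simps)
  have "m \<le> Re p * Re s"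
  proof (cases "Re s = 0")
    case True
    have "m = 0"
    proof (rule ccontr)
      assume "m \<noteq> 0"
      \<comment> \<open>The quadratic degenerates to a line of slope \<open>- 2 m\<close>, which takes the value \<open>-1\<close> here.\<close>
      then show False
        using quadratic[of "(Re p + 1) / (2 * m)"] True by simp
    qed
    then show ?thesis
      using True by simp
  next
    case False
    \<comment> \<open>The quadratic is minimal at \<open>t = 1 / Re s\<close>.\<close>
    then show ?thesis
      using quadratic[of "1 / Re s"] Re_nonneg by (simp add: field_simps)
  qed
  then show ?thesis
    by (simp add: m_def)
qed

text \<open>
  Conjugate symmetry comes out of the diagonal values being real. This is what makes the inequality
  applicable to the form \<open>(Ph,k)\<close>, where self-adjointness of \<open>P\<close> is a consequence of positivity.
\<close>

lemma Cauchy_Schwarz_semidefinite: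
  fixes B :: "'h::complex_vector \<Rightarrow> 'h \<Rightarrow> complex"
  assumes add_left: "\<And>x y z. B (x + y) z = B x z + B y z"
    and add_right: "\<And>x y z. B x (y + z) = B x y + B x z"
    and scale_left: "\<And>a x y. B (a *\<^sub>C x) y = a * B x y"
    and scale_right: "\<And>a x y. B x (a *\<^sub>C y) = cnj a * B x y"
    and semidefinite: "\<And>x. B x x \<in> \<real>\<^sub>\<ge>\<^sub>0"
  shows "(cmod (B x y))\<^sup>2 \<le> Re (B x x) * Re (B y y)"
proof (rule semidefinite_expansion_bound)
  show "B x x + cnj a * B x y + a * B y x + a * cnj a * B y y \<in> \<real>\<^sub>\<ge>\<^sub>0" for a
    using semidefinite[of "x + a *\<^sub>C y"]
    by (simp add: add_left add_right scale_left scale_right algebra_simps)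
qed (rule semidefinite)+

lemma cinner_add_right: "cinner x (y + z) = cinner x y + cinner (x :: 'h::complex_hilbert) z"
  by (simp add: cinner_add_left cinner_commute[of x y] cinner_commute[of x z]
      cinner_commute[of x "y + z"])

lemma cinner_scaleC_right: "cinner x (a *\<^sub>C y) = cnj a * cinner (x :: 'h::complex_hilbert) y"
  by (simp add: cinner_scaleC_left cinner_commute[of x y] cinner_commute[of x "a *\<^sub>C y"])

lemma cinner_scaleR_left: "cinner (r *\<^sub>R x) y = of_real r * cinner (x :: 'h::complex_hilbert) y"
  by (simp add: scaleR_eq_scaleC cinner_scaleC_left)

lemma cinner_diff_left: "cinner (x - y) z = cinner x z - cinner (y :: 'h::complex_hilbert) z"
  using cinner_add_left[of "x - y" y z] by simp

lemma cinner_self: "cinner x x = of_real ((norm (x :: 'h::complex_hilbert))\<^sup>2)"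
  using cinner_nonneg[of x]
  by (simp add: norm_eq_sqrt_cinner complex_nonneg_Reals_iff complex_eq_iff)

lemma cmod_cinner_le: "cmod (cinner x y) \<le> norm x * norm (y :: 'h::complex_hilbert)"
proof -
  have "(cmod (cinner x y))\<^sup>2 \<le> Re (cinner x x) * Re (cinner y y)"
    by (rule Cauchy_Schwarz_semidefinite[where B = cinner])
      (simp_all add: cinner_add_left cinner_add_right cinner_scaleC_left cinner_scaleC_right
        cinner_nonneg)
  then have "(cmod (cinner x y))\<^sup>2 \<le> (norm x * norm y)\<^sup>2"
    by (simp add: cinner_self power_mult_distrib)
  then show ?thesis
    by (rule power2_le_imp_le) simp
qed

lemma Cauchy_Schwarz_positive_op:
  fixes P :: "'h::complex_hilbert \<Rightarrow>\<^sub>L 'h"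
  assumes "P \<in> operators" and "positive_op P"
  shows "(cmod (cinner (P x) y))\<^sup>2 \<le> Re (cinner (P x) x) * Re (cinner (P y) y)"
  using assms
  by (intro Cauchy_Schwarz_semidefinite[where B = "\<lambda>h. cinner (P h)"])
    (simp_all add: operators_def positive_op_def blinfun.add_right cinner_add_left
      cinner_add_right cinner_scaleC_left cinner_scaleC_right)

lemma op_le_scaled_id_quadratic_form:
  fixes P :: "'h::complex_hilbert \<Rightarrow>\<^sub>L 'h"
  assumes "positive_op P"
  shows "P \<preceq> \<epsilon> *\<^sub>R id_blinfun \<longleftrightarrow> (\<forall>h. Re (cinner (P h) h) \<le> \<epsilon> * (norm h)\<^sup>2)"
  using assms
  by (simp add: op_le_def positive_op_def complex_nonneg_Reals_iff blinfun.diff_left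
      blinfun.scaleR_left cinner_diff_left cinner_scaleR_left cinner_self
      flip: of_real_power)

text \<open>
  The substance is the passage from the quadratic form to the norm: by Cauchy-Schwarz for the form
  \<open>(Ph,k)\<close>, its diagonal values control \<open>\<parallel>Ph\<parallel>\<^sup>2 = (Ph,Ph)\<close>.
\<close>

lemma op_le_scaled_id_iff:
  fixes P :: "'h::complex_hilbert \<Rightarrow>\<^sub>L 'h"
  assumes P: "P \<in> operators" "positive_op P" and "\<epsilon> \<ge> 0"
  shows "P \<preceq> \<epsilon> *\<^sub>R id_blinfun \<longleftrightarrow> norm P \<le> \<epsilon>"
  unfolding op_le_scaled_id_quadratic_form[OF P(2)]
proof
  assume form_le: "\<forall>h. Re (cinner (P h) h) \<le> \<epsilon> * (norm h)\<^sup>2"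
  show "norm P \<le> \<epsilon>"
  proof (rule norm_blinfun_bound[OF \<open>\<epsilon> \<ge> 0\<close>])
    fix h
    define k where "k = P h"
    have "((norm k)\<^sup>2)\<^sup>2 = (cmod (cinner (P h) k))\<^sup>2"
      by (simp add: k_def cinner_self norm_power)
    also have "\<dots> \<le> Re (cinner (P h) h) * Re (cinner (P k) k)"
      by (rule Cauchy_Schwarz_positive_op[OF P])
    also have "\<dots> \<le> (\<epsilon> * (norm h)\<^sup>2) * (\<epsilon> * (norm k)\<^sup>2)"
      using form_le P(2) \<open>\<epsilon> \<ge> 0\<close>
      by (intro mult_mono) (auto simp: positive_op_def complex_nonneg_Reals_iff)
    also have "\<dots> = (\<epsilon> * norm h)\<^sup>2 * (norm k)\<^sup>2"
      by (simp add: power2_eq_square)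
    finally have "(norm k)\<^sup>2 * (norm k)\<^sup>2 \<le> (\<epsilon> * norm h)\<^sup>2 * (norm k)\<^sup>2"
      by (simp add: power2_eq_square)
    then have "k = 0 \<or> (norm k)\<^sup>2 \<le> (\<epsilon> * norm h)\<^sup>2"
      by (metis mult_right_le_imp_le zero_less_norm_iff zero_less_power)
    then show "norm (P h) \<le> \<epsilon> * norm h"
      using \<open>\<epsilon> \<ge> 0\<close> by (auto simp: k_def dest: power2_le_imp_le)
  qed
next
  assume norm_le: "norm P \<le> \<epsilon>"
  show "\<forall>h. Re (cinner (P h) h) \<le> \<epsilon> * (norm h)\<^sup>2"
  proof
    fix h
    have "Re (cinner (P h) h) \<le> norm (P h) * norm h"
      using complex_Re_le_cmod cmod_cinner_le by (rule order_trans)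
    also have "\<dots> \<le> (\<epsilon> * norm h) * norm h"
      by (intro mult_right_mono norm_blinfun[THEN order_trans] norm_le norm_ge_zero)
    finally show "Re (cinner (P h) h) \<le> \<epsilon> * (norm h)\<^sup>2"
      by (simp add: power2_eq_square)
  qed
qed

theorem theorem2p4:
  fixes F :: "'x::complex_vector \<Rightarrow> ('h::complex_hilbert \<Rightarrow>\<^sub>L 'h)"
    and xs :: "nat \<Rightarrow> 'x" and x :: 'x
  assumes "\<exists>h::'h. h \<noteq> 0"
    and "operator_valued_norm F"
  shows "converges_wrt F xs x \<longleftrightarrow>
    (\<forall>\<epsilon>>0. \<exists>N. \<forall>n\<ge>N. norm (F (xs n - x)) \<le> \<epsilon>)"
proof -
  have "F y \<in> operators" "positive_op (F y)" for y
    using assms(2) by (simp_all add: operator_valued_norm_def op_le_def)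
  then show ?thesis
    by (simp add: converges_wrt_def op_le_scaled_id_iff)
qed

end
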